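(* Let $s > 0$ be a real number. For every integer $n \ge 0$, $$\det\left(H_{i+j}(1,s)\right)_{i,j=0}^{n} = \frac{(-1)^n\, s^{n-1}\left(s H_n + H_n(1,s)\right)}{\binom{2n+s-1}{n}\prod_{j=1}^{n-1}(2j+s)\binom{2j+s-1}{j}^2}.$$
   Context: For real $s>0$ and integers $m \ge 0$, $H_m(1,s) = \sum_{k=1}^{m} \frac{s}{k+s-1}$ (so $H_0(1,s)=0$), and $H_m = \sum_{k=1}^{m}\frac1k$ is the $m$-th harmonic number ($H_0=0$). For real $x$ and integer $k\ge 0$, $\binom{x}{k} = \frac{x(x-1)\cdots(x-k+1)}{k!}$. The notation $(a_{i,j})_{i,j=0}^{n}$ denotes the $(n+1)\times(n+1)$ matrix with indices $0\le i,j\le n$. Empty products equal $1$. *)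

theory Defs
  imports "HOL-Analysis.Harmonic_Numbers" "Jordan_Normal_Form.Determinant"
begin

definition gen_harm :: "nat \<Rightarrow> real \<Rightarrow> real" where
  "gen_harm m s = (\<Sum>k = 1..m. s / (real k + s - 1))"

text \<open>
  Rows and columns are indexed from 0 to \<open>n\<close>. Since \<open>n\<close> is a variable, the
  matrix is of type \<open>real mat\<close>, so its determinant is \<open>Determinant.det\<close>, not the
  \<open>det\<close> of \<open>HOL-Analysis\<close>.
\<close>
definition harm_hankel :: "nat \<Rightarrow> real \<Rightarrow> real mat" where
  "harm_hankel n s = mat (n + 1) (n + 1) (\<lambda>(i, j). gen_harm (i + j) s)"

end

theory Submission
  imports Defs "HOL-Real_Asymp.Real_Asymp"
begin

text \<open>
  Write \<open>h\<^sub>m = \<Sum>j<m. 1 / (s + j)\<close>, and let \<open>p\<^sub>k\<close> be the polynomials on \<open>[0, 1]\<close> that are orthogonal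
  for the weight \<open>x powr (s - 1)\<close> (shifted Jacobi), normalised by \<open>p\<^sub>k(1) = 1\<close>. Applying the
  coefficients of \<open>p\<^sub>k\<close> to the \<open>a\<close>-th row of the Hankel matrix of \<open>h\<close> gives a value that does not
  depend on \<open>a \<le> k\<close>, because passing from row \<open>a\<close> to row \<open>a + 1\<close> changes it by the integral of
  \<open>x powr (a + s - 1) * p\<^sub>k(x)\<close>, which vanishes for \<open>a < k\<close>. Subtracting consecutive rows therefore makes the
  matrix triangular, and the last diagonal entry is the common value for \<open>k = n\<close>, namely the \<open>n\<close>-th
  harmonic number plus \<open>h\<^sub>n\<close>.
\<close>

section \<open>Partial fractions by Lagrange interpolation\<close>

text \<open>The Lagrange interpolant \<open>q\<close> of \<open>p\<close> at the nodes
  \<open>x i\<close> equals \<open>p\<close> by the degree bound; dividing it by the node polynomial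
  gives the expansion.\<close>

lemma lagrange_partial_fractions:
  fixes p :: "'a :: field poly"
  assumes "finite I" and inj: "inj_on x I" and deg: "degree p < card I" and t: "t \<notin> x ` I"
  shows "(\<Sum>i\<in>I. poly p (x i) / (\<Prod>l\<in>I - {i}. x i - x l) / (t - x i)) =
    poly p t / (\<Prod>i\<in>I. t - x i)"
proof -
  define w where "w i = poly p (x i) / (\<Prod>l\<in>I - {i}. x i - x l)" for i
  define q where "q = (\<Sum>i\<in>I. smult (w i) (\<Prod>l\<in>I - {i}. [:- x l, 1:]))"
  have poly_q: "poly q u = (\<Sum>i\<in>I. w i * (\<Prod>l\<in>I - {i}. u - x l))" for u
    by (simp add: q_def poly_sum poly_prod)
  have "degree (smult (w i) (\<Prod>l\<in>I - {i}. [:- x l, 1:])) \<le> card I - 1" if "i \<in> I" for i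
  proof -
    have "degree (\<Prod>l\<in>I - {i}. [:- x l, 1:]) \<le> card (I - {i})"
      using degree_prod_sum_le[of "I - {i}" "\<lambda>l. [:- x l, 1:]"] \<open>finite I\<close> by simp
    then show ?thesis
      using that \<open>finite I\<close> degree_smult_le order_trans by fastforce
  qed
  then have "degree q \<le> card I - 1"
    unfolding q_def by (intro degree_sum_le \<open>finite I\<close>) auto
  then have deg_q: "degree q < card I"
    using deg by linarith
  have "p = q"
  proof (rule poly_eqI_degree)
    fix u assume "u \<in> x ` I"
    then obtain j where j: "j \<in> I" "u = x j" by blast
    have "poly q u = (\<Sum>i\<in>I. if i = j then w j * (\<Prod>l\<in>I - {j}. x j - x l) else 0)"
      unfolding poly_q j(2) using j(1) \<open>finite I\<close> by (intro sum.cong) auto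
    also have "\<dots> = poly p (x j)"
      using j(1) \<open>finite I\<close> inj by (auto simp: w_def inj_on_def)
    finally show "poly p u = poly q u" using j by simp
  qed (use deg deg_q inj in \<open>simp_all add: card_image\<close>)
  have nz: "t - x i \<noteq> 0" if "i \<in> I" for i
    using that t by auto
  have "poly p t / (\<Prod>i\<in>I. t - x i) =
      (\<Sum>i\<in>I. w i * (\<Prod>l\<in>I - {i}. t - x l) / (\<Prod>i\<in>I. t - x i))"
    by (simp add: \<open>p = q\<close> poly_q sum_divide_distrib)
  also have "\<dots> = (\<Sum>i\<in>I. w i / (t - x i))"
    using nz \<open>finite I\<close> by (intro sum.cong) (auto simp: prod.remove[of I] prod_zero_iff)
  finally show ?thesis by (simp add: w_def)
qed

section \<open>Coefficients and moments of the Jacobi polynomials\<close>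

text \<open>
  The coefficient of \<open>x^i\<close> in \<open>p\<^sub>k\<close>, written as the residue at \<open>t = - i\<close> of the Mellin transform
  \<open>jacobi_mellin s k t\<close>, the integral of \<open>x powr (t - 1) * p\<^sub>k(x)\<close> over \<open>[0, 1]\<close>.
\<close>

definition jacobi_coeff :: "real \<Rightarrow> nat \<Rightarrow> nat \<Rightarrow> real" where
  "jacobi_coeff s k i =
    (\<Prod>j<k. - real i - s - real j) / (\<Prod>l\<in>{..k} - {i}. real l - real i)"

definition jacobi_mellin :: "real \<Rightarrow> nat \<Rightarrow> real \<Rightarrow> real" where
  "jacobi_mellin s k t = (\<Prod>j<k. t - s - real j) / (\<Prod>i\<le>k. t + real i)"

text \<open>The left side integrates p_k termwise. It is the partial fraction expansion of the right
  side, whose numerator has degree k, below the number k + 1 of poles.\<close>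

lemma sum_jacobi_coeff_div:
  assumes "t > 0"
  shows "(\<Sum>i\<le>k. jacobi_coeff s k i / (t + real i)) = jacobi_mellin s k t"
proof -
  define p where "p = (\<Prod>j<k. [:- s - real j, 1:])"
  have poly_p: "poly p u = (\<Prod>j<k. u - s - real j)" for u
    unfolding p_def poly_prod by (intro prod.cong) auto
  have "degree p \<le> k"
    using degree_prod_sum_le[of "{..<k}" "\<lambda>j. [:- s - real j, 1:]"] by (simp add: p_def)
  moreover have "t \<notin> (\<lambda>i. - real i) ` {..k}"
    using assms by auto
  ultimately show ?thesis
    using lagrange_partial_fractions[of "{..k}" "\<lambda>i. - real i" p t]
    by (simp add: inj_on_def poly_p jacobi_coeff_def jacobi_mellin_def add.commute)
qed

lemma prod_diff_eq_fact: "(\<Prod>j<k. real k - real j) = fact k"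
  by (simp add: fact_prod_rev atLeast0LessThan of_nat_diff)

lemma jacobi_coeff_diag: "jacobi_coeff s k k = (2 * real k + s - 1) gchoose k"
proof -
  have "(\<Prod>l\<in>{..k} - {k}. real l - real k) = (\<Prod>l<k. (-1) * (real k - real l))"
    by (intro prod.cong) auto
  also have "\<dots> = (-1) ^ k * fact k"
    by (simp only: prod.distrib prod_diff_eq_fact) simp
  finally have den: "(\<Prod>l\<in>{..k} - {k}. real l - real k) = (-1) ^ k * fact k" .
  have "(\<Prod>j<k. - real k - s - real j) = (\<Prod>j<k. (-1) * (real k + s + real j))"
    by (intro prod.cong) auto
  also have "\<dots> = (-1) ^ k * (\<Prod>j<k. real k + s + real j)"
    by (simp only: prod.distrib) simp
  also have "(\<Prod>j<k. real k + s + real j) = pochhammer (real k + s) k"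
    by (simp add: pochhammer_prod atLeast0LessThan)
  finally have num: "(\<Prod>j<k. - real k - s - real j) = (-1) ^ k * pochhammer (real k + s) k" .
  show ?thesis
    unfolding jacobi_coeff_def num den by (simp add: gbinomial_pochhammer' algebra_simps)
qed

text \<open>Orthogonality of p_k to x^m: the factor j = m vanishes.\<close>

lemma jacobi_mellin_zero: "m < k \<Longrightarrow> jacobi_mellin s k (s + real m) = 0"
  by (auto simp: jacobi_mellin_def)

lemma jacobi_mellin_self:
  assumes "s > 0"
  shows "jacobi_mellin s k (s + real k) =
    1 / (((2 * real k + s - 1) gchoose k) * (2 * real k + s))"
proof -
  have den: "(\<Prod>i\<le>k. s + real k + real i) = pochhammer (s + real k) k * (2 * real k + s)"
    by (simp add: pochhammer_prod atLeast0LessThan lessThan_Suc_atMost[symmetric])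
  show ?thesis
    unfolding jacobi_mellin_def den by (simp add: prod_diff_eq_fact gbinomial_pochhammer' algebra_simps)
qed

lemma tendsto_shift_ratio:
  "(\<lambda>m. (t + real m - a) / (t + real m + b)) \<longlonglongrightarrow> 1"
  by real_asymp

lemma tendsto_inverse_shift: "(\<lambda>m. c / (t + real m)) \<longlonglongrightarrow> 0"
  by real_asymp

text \<open>The normalisation p_k(1) = 1. Multiply the partial fraction expansion by t and let t
  tend to infinity: each t / (t + i) tends to 1, and \<open>t * jacobi_mellin s k t\<close> is a
  quotient of monic polynomials of degree k once t is cancelled.\<close>

lemma sum_jacobi_coeff: "(\<Sum>i\<le>k. jacobi_coeff s k i) = 1"
proof (rule LIMSEQ_unique)
  let ?t = "\<lambda>m. 1 + real m"
  have "(\<lambda>m. \<Sum>i\<le>k. jacobi_coeff s k i * ((?t m - 0) / (?t m + real i)))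
      \<longlonglongrightarrow> (\<Sum>i\<le>k. jacobi_coeff s k i * 1)"
    by (intro tendsto_intros tendsto_shift_ratio)
  moreover have "(\<Sum>i\<le>k. jacobi_coeff s k i * ((?t m - 0) / (?t m + real i))) =
      ?t m * jacobi_mellin s k (?t m)" for m
    by (subst sum_jacobi_coeff_div[symmetric]) (auto simp: sum_distrib_left mult_ac)
  ultimately show "(\<lambda>m. ?t m * jacobi_mellin s k (?t m)) \<longlonglongrightarrow> (\<Sum>i\<le>k. jacobi_coeff s k i)"
    by simp
  have "(\<lambda>m. (\<Prod>j<k. (?t m - (s + real j)) / (?t m + real (Suc j)))) \<longlonglongrightarrow> (\<Prod>j<k. 1)"
    by (intro tendsto_prod tendsto_shift_ratio)
  moreover have "(\<Prod>j<k. (?t m - (s + real j)) / (?t m + real (Suc j))) =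
      ?t m * jacobi_mellin s k (?t m)" for m
    by (simp add: jacobi_mellin_def prod_dividef diff_diff_eq lessThan_Suc_atMost[symmetric]
        prod.lessThan_Suc_shift del: prod.lessThan_Suc)
  ultimately show "(\<lambda>m. ?t m * jacobi_mellin s k (?t m)) \<longlonglongrightarrow> 1"
    by simp
qed

section \<open>Harmonic sums weighted by the Jacobi coefficients\<close>

definition shifted_harm :: "nat \<Rightarrow> real \<Rightarrow> real" where
  "shifted_harm m t = (\<Sum>j<m. 1 / (t + real j))"

lemma gen_harm_conv_shifted_harm: "gen_harm m s = s * shifted_harm m s"
proof -
  have "gen_harm m s = (\<Sum>j<m. s / (real (Suc j) + s - 1))"
    unfolding gen_harm_def
    by (intro sum.reindex_bij_witness[of _ Suc "\<lambda>k. k - 1"]) auto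
  then show ?thesis
    by (simp add: shifted_harm_def sum_distrib_left algebra_simps)
qed

lemma shifted_harm_Suc: "shifted_harm (Suc m) t = shifted_harm m t + 1 / (t + real m)"
  by (simp add: shifted_harm_def)

lemma shifted_harm_shift:
  "shifted_harm m t - shifted_harm m (t + 1) = 1 / t - 1 / (t + real m)"
  by (induction m) (simp_all add: shifted_harm_def algebra_simps)

text \<open>The value for row 0, with \<open>t\<close> free instead of fixed to \<open>s\<close>, so
  that it can be found from a difference equation in \<open>t\<close>.\<close>

definition jacobi_harm :: "real \<Rightarrow> nat \<Rightarrow> real \<Rightarrow> real" where
  "jacobi_harm s k t = (\<Sum>i\<le>k. jacobi_coeff s k i * shifted_harm i t)"

text \<open>The term 1 / t comes from the coefficients summing to 1; being independent of k, it
  cancels between consecutive k.\<close>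

lemma jacobi_harm_shift:
  assumes "t > 0"
  shows "jacobi_harm s k t - jacobi_harm s k (t + 1) = 1 / t - jacobi_mellin s k t"
proof -
  have "jacobi_harm s k t - jacobi_harm s k (t + 1) =
      (\<Sum>i\<le>k. jacobi_coeff s k i * (1 / t - 1 / (t + real i)))"
    by (simp add: jacobi_harm_def sum_subtractf[symmetric] right_diff_distrib[symmetric]
        shifted_harm_shift)
  also have "\<dots> = (\<Sum>i\<le>k. jacobi_coeff s k i) / t - (\<Sum>i\<le>k. jacobi_coeff s k i / (t + real i))"
    by (simp add: right_diff_distrib sum_subtractf sum_divide_distrib)
  finally show ?thesis
    by (simp add: sum_jacobi_coeff sum_jacobi_coeff_div assms)
qed

lemma tendsto_jacobi_harm: "(\<lambda>m. jacobi_harm s k (t + real m)) \<longlonglongrightarrow> 0"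
proof -
  have "(\<lambda>m. \<Sum>i\<le>k. jacobi_coeff s k i * (\<Sum>j<i. 1 / (t + real j + real m)))
      \<longlonglongrightarrow> (\<Sum>i\<le>k. jacobi_coeff s k i * (\<Sum>j<i. 0))"
    by (intro tendsto_intros tendsto_inverse_shift)
  then show ?thesis
    by (simp add: jacobi_harm_def shifted_harm_def add_ac)
qed

lemma jacobi_harm_Suc:
  assumes "s > 0"
  shows "jacobi_harm s (Suc k) s = jacobi_harm s k s + 1 / real (Suc k) + 1 / (s + real k)"
proof -
  \<comment> \<open>\<open>c\<close> is the quotient of the right sides of \<open>dG\<close> and
    \<open>dR\<close> below, with the common factors cancelled.\<close>
  define c where "c = 1 / real (Suc k) + 1 / (s + real k)"
  \<comment> \<open>The numerator is that of \<open>jacobi_mellin s (Suc k)\<close>, the denominator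
    that of \<open>jacobi_mellin s k\<close>.\<close>
  define R where "R t = (\<Prod>j\<le>k. t - s - real j) / (\<Prod>i\<le>k. t + real i)" for t
  \<comment> \<open>Gosper summation: \<open>c * R\<close> is an antidifference of
    \<open>jacobi_mellin s k - jacobi_mellin s (Suc k)\<close>, so \<open>D\<close> is 1-periodic and hence equal to its limit.\<close>
  define D where "D t = jacobi_harm s (Suc k) t - jacobi_harm s k t + c * R t" for t
  have periodic: "D (t + 1) = D t" if "t > 0" for t
  proof -
    define r where "r = real k"
    \<comment> \<open>\<open>P\<close> and \<open>Q\<close> collect the factors shared by both
      Mellin transforms and by \<open>R\<close> at t and t + 1, leaving a rational identity in r, s
      and t. \<open>P\<close> may be 0, so only \<open>Q\<close> is shown to be nonzero.\<close>
    define P where "P = (\<Prod>j<k. t - s - real j)"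
    define Q where "Q = (\<Prod>i<k. t + 1 + real i)"
    have Q: "Q > 0"
      unfolding Q_def using that by (intro prod_pos) auto
    have Q_shift: "(\<Prod>i<Suc k. t + real i) = t * Q"
      by (simp add: Q_def prod.lessThan_Suc_shift algebra_simps del: prod.lessThan_Suc)
    have P_shift: "(\<Prod>j<Suc k. t + 1 - s - real j) = (t + 1 - s) * P"
      by (simp add: P_def prod.lessThan_Suc_shift algebra_simps del: prod.lessThan_Suc)
    have nz: "t \<noteq> 0" "t + 1 + r \<noteq> 0" "1 + r \<noteq> 0" "s + r \<noteq> 0"
      using that assms by (auto simp: r_def)
    have R: "R t = P * (t - s - real k) / (t * Q)"
      unfolding R_def lessThan_Suc_atMost[symmetric] Q_shift by (simp add: P_def)
    have R': "R (t + 1) = (t + 1 - s) * P / (Q * (t + 1 + real k))"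
      unfolding R_def lessThan_Suc_atMost[symmetric] P_shift by (simp add: Q_def)
    have G: "jacobi_mellin s k t = P / (t * Q)"
      unfolding jacobi_mellin_def lessThan_Suc_atMost[symmetric] Q_shift P_def ..
    have G': "jacobi_mellin s (Suc k) t = P * (t - s - real k) / (t * Q * (t + 1 + real k))"
      unfolding jacobi_mellin_def lessThan_Suc_atMost[symmetric] prod.lessThan_Suc[of _ "Suc k"] Q_shift
      by (simp add: P_def add_ac)
    have c_eq: "c = (2 * r + s + 1) / ((1 + r) * (s + r))"
      using nz unfolding c_def of_nat_Suc r_def[symmetric] by (simp add: divide_simps)
    have dR: "R (t + 1) - R t = P * ((1 + r) * (s + r)) / (t * Q * (t + 1 + r))"
      using nz Q unfolding R R' r_def[symmetric] by (simp add: divide_simps) (simp add: algebra_simps)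
    have dG: "jacobi_mellin s k t - jacobi_mellin s (Suc k) t =
        P * (2 * r + s + 1) / (t * Q * (t + 1 + r))"
      using nz Q unfolding G G' r_def[symmetric] by (simp add: divide_simps) (simp add: algebra_simps)
    have "c * (R (t + 1) - R t) = jacobi_mellin s k t - jacobi_mellin s (Suc k) t"
      using nz unfolding dR dG c_eq by simp
    then show ?thesis
      using jacobi_harm_shift[OF that, of s k] jacobi_harm_shift[OF that, of s "Suc k"]
      by (simp add: D_def algebra_simps)
  qed
  have const: "D (s + real m) = D s" for m
    using assms periodic[of "s + real m" for m] by (induction m) (simp_all add: add_ac)
  have "(\<lambda>m. \<Prod>j\<le>k. (s + real m - (s + real j)) / (s + real m + real j)) \<longlonglongrightarrow> (\<Prod>j\<le>k. 1)"
    by (intro tendsto_prod tendsto_shift_ratio)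
  then have "(\<lambda>m. R (s + real m)) \<longlonglongrightarrow> 1"
    by (simp add: R_def prod_dividef diff_diff_eq)
  \<comment> \<open>Only \<open>c * R\<close> survives in the limit, while at t = s it vanishes
    through the factor j = 0; so the constant value of \<open>D\<close> is the increment.\<close>
  then have "(\<lambda>m. D (s + real m)) \<longlonglongrightarrow> 0 - 0 + c * 1"
    unfolding D_def by (intro tendsto_intros tendsto_jacobi_harm)
  then have "D s = c"
    unfolding const by (simp add: LIMSEQ_const_iff)
  moreover have "R s = 0"
    by (auto simp: R_def)
  ultimately show ?thesis
    by (simp add: D_def c_def)
qed

lemma jacobi_harm_eq:
  assumes "s > 0"
  shows "jacobi_harm s k s = harm k + shifted_harm k s"
proof (induction k)
  case 0
  show ?case by (simp add: jacobi_harm_def shifted_harm_def harm_def)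
next
  case (Suc k)
  then show ?case
    using assms by (simp add: jacobi_harm_Suc harm_Suc shifted_harm_Suc divide_inverse)
qed

section \<open>Triangularisation of the Hankel matrix\<close>

lemma sum_jacobi_coeff_shifted_harm_diff:
  assumes "s > 0"
  shows "(\<Sum>i\<le>k. jacobi_coeff s k i * shifted_harm (Suc a + i) s) -
    (\<Sum>i\<le>k. jacobi_coeff s k i * shifted_harm (a + i) s) = jacobi_mellin s k (s + real a)"
  using assms sum_jacobi_coeff_div[of "s + real a" s k]
  by (simp add: shifted_harm_Suc sum_subtractf[symmetric] algebra_simps)

text \<open>Orthogonality is needed only for steps from a < k to a + 1, so row k is still reached;
  it supplies the last diagonal entry.\<close>

lemma sum_jacobi_coeff_shifted_harm:
  assumes "s > 0" and "a \<le> k"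
  shows "(\<Sum>i\<le>k. jacobi_coeff s k i * shifted_harm (a + i) s) = jacobi_harm s k s"
  using assms(2)
proof (induction a)
  case (Suc a)
  then show ?case
    using sum_jacobi_coeff_shifted_harm_diff[OF assms(1), of k a]
      jacobi_mellin_zero[of a k s] by simp
qed (simp add: jacobi_harm_def)

text \<open>Column k of \<open>?U\<close> holds the coefficients of p_k, and \<open>?B\<close>, of
  determinant 1, subtracts from each row the next one; \<open>L\<close> is
  \<open>?B * (?M * ?U)\<close>.\<close>

lemma det_shifted_harm:
  assumes "s > 0"
  shows "Determinant.det (mat (n + 1) (n + 1) (\<lambda>(i, j). shifted_harm (i + j) s)) *
      (\<Prod>k\<le>n. jacobi_coeff s k k) =
    jacobi_harm s n s * (\<Prod>k<n. - jacobi_mellin s k (s + real k))"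
proof -
  let ?M = "mat (n + 1) (n + 1) (\<lambda>(i, j). shifted_harm (i + j) s)"
  let ?U = "mat (n + 1) (n + 1) (\<lambda>(i, k). if i \<le> k then jacobi_coeff s k i else 0)"
  let ?B = "mat (n + 1) (n + 1)
    (\<lambda>(i, k). if k = i then 1 else if k = Suc i then - 1 else 0 :: real)"
  define f where "f a k = (\<Sum>i\<le>k. jacobi_coeff s k i * shifted_harm (a + i) s)" for a k
  define N where "N = ?M * ?U"
  have N: "N \<in> carrier_mat (n + 1) (n + 1)"
    unfolding N_def by (rule mult_carrier_mat[where n = "n + 1"]) auto
  have N_index: "N $$ (a, k) = f a k" if "a \<le> n" "k \<le> n" for a k
  proof -
    have "N $$ (a, k) =
        (\<Sum>i = 0..<n + 1. shifted_harm (a + i) s * (if i \<le> k then jacobi_coeff s k i else 0))"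
      using that by (simp add: N_def scalar_prod_def)
    also have "\<dots> = f a k"
      unfolding f_def using that by (intro sum.mono_neutral_cong_right) auto
    finally show ?thesis .
  qed
  define L where "L = ?B * N"
  have L: "L \<in> carrier_mat (n + 1) (n + 1)"
    unfolding L_def by (rule mult_carrier_mat[OF _ N]) simp
  \<comment> \<open>The last row of \<open>?B\<close> has no entry -1, as its column would be n + 1,
    so row n is not differenced.\<close>
  have L_index: "L $$ (a, k) = (if a = n then f n k else f a k - f (Suc a) k)"
    if "a \<le> n" "k \<le> n" for a k
  proof -
    have "L $$ (a, k) = (\<Sum>i = 0..<n + 1. ?B $$ (a, i) * N $$ (i, k))"
      using that N by (simp add: L_def scalar_prod_def)
    also have "\<dots> = (\<Sum>i = 0..<n + 1. (if i = a then f i k else 0) - (if i = Suc a then f i k else 0))"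
      using that by (intro sum.cong) (auto simp: N_index)
    also have "\<dots> = (\<Sum>i = 0..<n + 1. if i = a then f i k else 0) -
        (\<Sum>i = 0..<n + 1. if i = Suc a then f i k else 0)"
      by (rule sum_subtractf)
    also have "\<dots> = (if a = n then f n k else f a k - f (Suc a) k)"
      using that by simp
    finally show ?thesis .
  qed
  have diff: "f a k - f (Suc a) k = - jacobi_mellin s k (s + real a)" for a k
    using sum_jacobi_coeff_shifted_harm_diff[OF assms, of k a] by (simp add: f_def)
  have "Determinant.det L = prod_list (diag_mat L)"
  proof (rule det_lower_triangular)
    \<comment> \<open>Above the diagonal i < n, so the entry is a difference and orthogonality
      applies.\<close>
    show "L $$ (i, j) = 0" if "i < j" "j < n + 1" for i j
      using that by (simp add: L_index diff jacobi_mellin_zero)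
  qed (rule L)
  also have "\<dots> = (\<Prod>k = 0..<n + 1. L $$ (k, k))"
    by (use L in \<open>simp add: prod_list_diag_prod\<close>)
  also have "\<dots> = (\<Prod>k<Suc n. if k = n then f n n else - jacobi_mellin s k (s + real k))"
    by (intro prod.cong) (auto simp: L_index diff)
  also have "\<dots> = jacobi_harm s n s * (\<Prod>k<n. - jacobi_mellin s k (s + real k))"
    using sum_jacobi_coeff_shifted_harm[OF assms, of n n] by (simp add: f_def mult.commute)
  finally have det_L: "Determinant.det L = \<dots>" .
  have "upper_triangular ?U" "upper_triangular ?B"
    by (auto simp: upper_triangular_def)
  then have "Determinant.det ?U = (\<Prod>k\<le>n. jacobi_coeff s k k)" and "Determinant.det ?B = 1"
    by (auto simp: det_upper_triangular[where n = "n + 1"] prod_list_diag_prod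
        atLeast0LessThan lessThan_Suc_atMost[symmetric])
  moreover have "Determinant.det L =
      Determinant.det ?B * (Determinant.det ?M * Determinant.det ?U)"
    unfolding L_def N_def by (simp add: det_mult[where n = "n + 1"] mult_carrier_mat[where n = "n + 1"])
  ultimately show ?thesis
    using det_L by simp
qed

theorem theorem5p1:
  fixes s :: real and n :: nat
  assumes "s > 0"
  shows "Determinant.det (harm_hankel n s) =
    (-1) ^ n * s powi (int n - 1) * (s * harm n + gen_harm n s) /
    (((2 * real n + s - 1) gchoose n) *
     (\<Prod>j = 1..<n. (2 * real j + s) * ((2 * real j + s - 1) gchoose j)\<^sup>2))"
proof -
  define C where "C j = (2 * real j + s - 1) gchoose j" for j
  define M where "M = mat (n + 1) (n + 1) (\<lambda>(i, j). shifted_harm (i + j) s)"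
  define l where "l = harm n + shifted_harm n s"
  have C_pos: "C j > 0" for j
    unfolding C_def gbinomial_pochhammer' using assms by (auto intro!: divide_pos_pos pochhammer_pos)
  have prod_C: "(\<Prod>k\<le>n. C k) \<noteq> 0"
    using C_pos by (simp add: less_imp_neq[THEN not_sym])
  have "harm_hankel n s = s \<cdot>\<^sub>m M"
    by (auto simp: harm_hankel_def M_def gen_harm_conv_shifted_harm)
  then have det_eq: "Determinant.det (harm_hankel n s) = s ^ Suc n * Determinant.det M"
    by (simp add: M_def)
  have "Determinant.det M * (\<Prod>k\<le>n. C k) = l * (\<Prod>k<n. (-1) * (1 / (C k * (2 * real k + s))))"
    using det_shifted_harm[OF assms, of n] assms
    by (simp add: M_def l_def C_def jacobi_coeff_diag jacobi_harm_eq jacobi_mellin_self)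
  also have "\<dots> = (-1) ^ n * l / (\<Prod>k<n. C k * (2 * real k + s))"
    by (simp only: prod.distrib prod_dividef) simp
  finally have "Determinant.det M =
      (-1) ^ n * l / ((\<Prod>k<n. C k * (2 * real k + s)) * (\<Prod>k\<le>n. C k))"
    unfolding divide_divide_eq_left[symmetric] by (simp only: nonzero_eq_divide_eq[OF prod_C])
  \<comment> \<open>For k < n, \<open>C k\<close> arises from both the leading coefficient and the
    moment; \<open>C n\<close> arises from the leading coefficient alone.\<close>
  also have "(\<Prod>k<n. C k * (2 * real k + s)) * (\<Prod>k\<le>n. C k) =
      C n * (\<Prod>k<n. (2 * real k + s) * (C k)\<^sup>2)"
    by (simp add: lessThan_Suc_atMost[symmetric] prod.distrib power2_eq_square mult_ac)
  finally have det_M: "Determinant.det M =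
      (-1) ^ n * l / (C n * (\<Prod>k<n. (2 * real k + s) * (C k)\<^sup>2))" .
  have l: "s * harm n + gen_harm n s = s * l"
    by (simp add: l_def gen_harm_conv_shifted_harm algebra_simps)
  show ?thesis
  \<comment> \<open>The stated product starts at j = 1; the factor k = 0 is s, since
    \<open>C 0\<close> is 1. For n = 0 there is no such factor, and both sides are 0.\<close>
  proof (cases n)
    case 0
    then show ?thesis
      unfolding det_eq det_M by (simp add: l_def harm_def shifted_harm_def gen_harm_def)
  next
    case (Suc m)
    have "(\<Prod>k<n. (2 * real k + s) * (C k)\<^sup>2) = s * (\<Prod>k = 1..<n. (2 * real k + s) * (C k)\<^sup>2)"
      using Suc by (simp add: lessThan_atLeast0 prod.atLeast_Suc_lessThan C_def)
    moreover have "s powi (int n - 1) = s ^ m"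
      using Suc by simp
    ultimately show ?thesis
      unfolding det_eq det_M l C_def[symmetric] using assms Suc by simp
  qed
qed

end
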